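(* Let $n\ge 1$, let $L,\bar M\in\mathbb{R}^{n\times n}$ (not necessarily symmetric), let $M\in\mathbb{R}^{n\times n}$ be diagonal with positive diagonal entries, let $\mathcal{I}\subseteq\{1,\dots,n\}$, and let $\alpha>0$ be such that $\sqrt{\alpha}L+\bar M\Pi_{\mathcal I}$ is nonsingular. Define $$\mathbb{S}=\alpha L M^{-1}L^T+\bar M\,\Pi_{\mathcal I}\,M^{-1}\bar M^T,\qquad \widehat{\mathbb S}=(\sqrt{\alpha}L+\bar M\Pi_{\mathcal I})\,M^{-1}\,(\sqrt{\alpha}L+\bar M\Pi_{\mathcal I})^T .$$ Let $\lambda$ be an eigenvalue of $\widehat{\mathbb S}^{-1}\mathbb S$. Then $$\frac12\le\lambda\le\zeta^2+(1+\zeta)^2,\qquad\text{where}\qquad \zeta=\left\|M^{\frac12}\left(\sqrt{\alpha}L+\bar M\Pi_{\mathcal I}\right)^{-1}\sqrt{\alpha}\,L\,M^{-\frac12}\right\| .$$ Moreover, if $L\bar M^T+\bar M L^T\succ 0$, then for $\alpha\to0$ (with $L$, $M$, $\bar M$, $\mathcal I$ fixed) $\zeta$ is bounded by a constant independent of $\alpha$; that is, there exist $C>0$ and $\alpha_0>0$ such that $\zeta=\zeta(\alpha)\le C$ for all $0<\alpha\le\alpha_0$.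
   Context: For an index set $\mathcal C\subseteq\{1,\dots,n\}$, $\Pi_{\mathcal C}\in\mathbb{R}^{n\times n}$ is the diagonal matrix with $i$-th diagonal entry $1$ if $i\in\mathcal C$ and $0$ otherwise. $\|\cdot\|$ is the spectral norm (the matrix norm induced by the Euclidean norm). $X\succ0$ means that the symmetric matrix $X$ is positive definite. *)

theory Defs
  imports "HOL-Analysis.Analysis"
begin

definition sel_matrix :: "'n set \<Rightarrow> real^'n^'n" where
  "sel_matrix I = (\<chi> i j. if i = j \<and> i \<in> I then 1 else 0)"

definition pos_diagonal :: "real^'n^'n \<Rightarrow> bool" where
  "pos_diagonal M \<longleftrightarrow> (\<forall>i j. i \<noteq> j \<longrightarrow> M $ i $ j = 0) \<and> (\<forall>i. 0 < M $ i $ i)"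

definition pos_def :: "real^'n^'n \<Rightarrow> bool" where
  "pos_def X \<longleftrightarrow> transpose X = X \<and> (\<forall>x. x \<noteq> 0 \<longrightarrow> 0 < x \<bullet> (X *v x))"

text \<open>The square root of a diagonal matrix with positive diagonal entries; only meant for
  such matrices, since off-diagonal entries are ignored.\<close>

definition diag_sqrt :: "real^'n^'n \<Rightarrow> real^'n^'n" where
  "diag_sqrt M = (\<chi> i j. if i = j then sqrt (M $ i $ i) else 0)"

lemma diag_sqrt_square:
  assumes "pos_diagonal M"
  shows "diag_sqrt M ** diag_sqrt M = M"
proof -
  have "(\<Sum>k\<in>UNIV. (if i = k then sqrt (M $ i $ i) else 0) * (if k = j then sqrt (M $ k $ k) else 0))
      = M $ i $ j" for i j
  proof -
    have "(\<Sum>k\<in>UNIV. (if i = k then sqrt (M $ i $ i) else 0) * (if k = j then sqrt (M $ k $ k) else 0))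
      = (\<Sum>k\<in>UNIV. if k = i then (if i = j then sqrt (M $ i $ i) * sqrt (M $ i $ i) else 0) else 0)"
      by (rule sum.cong) auto
    then show ?thesis
      using assms by (auto simp: pos_diagonal_def less_imp_le)
  qed
  then show ?thesis
    by (simp add: diag_sqrt_def matrix_matrix_mult_def vec_eq_iff)
qed

definition spectral_norm :: "real^'n^'n \<Rightarrow> real" where
  "spectral_norm A = onorm ((*v) A)"

text \<open>The eigenvalues of a real matrix are a priori complex.\<close>

definition is_eigenvalue :: "real^'n^'n \<Rightarrow> complex \<Rightarrow> bool" where
  "is_eigenvalue A \<mu> \<longleftrightarrow>
     (\<exists>v :: complex^'n. v \<noteq> 0 \<and> map_matrix complex_of_real A *v v = \<mu> *s v)"

definition schur_matrix ::
    "real^'n^'n \<Rightarrow> real^'n^'n \<Rightarrow> real^'n^'n \<Rightarrow> 'n set \<Rightarrow> real \<Rightarrow> real^'n^'n" where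
  "schur_matrix L Mbar M I \<alpha> =
     \<alpha> *\<^sub>R (L ** matrix_inv M ** transpose L)
     + Mbar ** sel_matrix I ** matrix_inv M ** transpose Mbar"

definition schur_factor :: "real^'n^'n \<Rightarrow> real^'n^'n \<Rightarrow> 'n set \<Rightarrow> real \<Rightarrow> real^'n^'n" where
  "schur_factor L Mbar I \<alpha> = sqrt \<alpha> *\<^sub>R L + Mbar ** sel_matrix I"

definition schur_approx ::
    "real^'n^'n \<Rightarrow> real^'n^'n \<Rightarrow> real^'n^'n \<Rightarrow> 'n set \<Rightarrow> real \<Rightarrow> real^'n^'n" where
  "schur_approx L Mbar M I \<alpha> =
     schur_factor L Mbar I \<alpha> ** matrix_inv M ** transpose (schur_factor L Mbar I \<alpha>)"

definition zeta ::
    "real^'n^'n \<Rightarrow> real^'n^'n \<Rightarrow> real^'n^'n \<Rightarrow> 'n set \<Rightarrow> real \<Rightarrow> real" where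
  "zeta L Mbar M I \<alpha> =
     spectral_norm (diag_sqrt M ** matrix_inv (schur_factor L Mbar I \<alpha>)
       ** (sqrt \<alpha> *\<^sub>R L) ** matrix_inv (diag_sqrt M))"

end

theory Submission
  imports Defs
begin

text \<open>
  Write \<open>F = \<surd>\<alpha> L + Mbar \<Pi>\<close> for the factor of the approximation. A diagonal
  \<open>M\<close> commutes with the coordinate projection \<open>\<Pi>\<close>, so with \<open>P = \<surd>\<alpha> L M\<^sup>-\<^sup>1\<^sup>/\<^sup>2\<close> and
  \<open>Q = Mbar \<Pi> M\<^sup>-\<^sup>1\<^sup>/\<^sup>2\<close> the exact matrix is \<open>P P\<^sup>T + Q Q\<^sup>T\<close>, while the approximation is
  \<open>(P + Q) (P + Q)\<^sup>T\<close>. The eigenvalues in question are therefore bounded by the extreme values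
  of the quotient of \<open>\<parallel>P\<^sup>T x\<parallel>\<^sup>2 + \<parallel>Q\<^sup>T x\<parallel>\<^sup>2\<close> and \<open>\<parallel>(P + Q)\<^sup>T x\<parallel>\<^sup>2\<close>
  (\<open>eigenvalue_of_symmetric_pair\<close>). The lower bound \<open>1/2\<close> is the parallelogram law. For the upper
  bound, \<open>\<zeta>\<close> is the norm of \<open>Z = (P + Q)\<^sup>-\<^sup>1 P\<close>. If \<open>y = (P + Q)\<^sup>T x\<close>, then
  \<open>P\<^sup>T x = Z\<^sup>T y\<close> and \<open>Q\<^sup>T x = y - Z\<^sup>T y\<close>, which have norms at most \<open>\<zeta> \<parallel>y\<parallel>\<close> and
  \<open>(1 + \<zeta>) \<parallel>y\<parallel>\<close> (\<open>gram_sum_upper\<close>).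

  For the boundedness of \<open>\<zeta>\<close> one needs an estimate \<open>\<parallel>x\<parallel> \<le> K \<parallel>y\<parallel>\<close> for the solutions of
  \<open>F x = \<surd>\<alpha> L y\<close> with \<open>K\<close> independent of \<open>\<alpha>\<close>. Positive definiteness of
  \<open>L Mbar\<^sup>T + Mbar L\<^sup>T\<close> makes \<open>Mbar\<close> nonsingular, so one can write \<open>x = Mbar\<^sup>T u\<close> and pair
  the equation with \<open>u\<close>:
  \<open>\<surd>\<alpha> u \<bullet> L Mbar\<^sup>T u + x \<bullet> \<Pi> x = \<surd>\<alpha> u \<bullet> L y\<close>. The term with \<open>\<Pi>\<close> is nonnegative and can be
  dropped; the factor \<open>\<surd>\<alpha>\<close> then cancels, and coercivity bounds \<open>u\<close> by \<open>y\<close>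
  (\<open>schur_factor_solution_bound\<close>). The case \<open>y = 0\<close> shows that \<open>F\<close> is nonsingular. Both
  conclusions hold for all \<open>\<alpha> > 0\<close>.
\<close>

section \<open>Matrices as operators on Euclidean space\<close>

\<comment> \<open>Transposes are kept as matrices, so that products with them can be regrouped.\<close>
declare transpose_matrix_vector [simp del]

lemma inner_matrix_transpose:
  fixes A :: "real^'n^'m"
  shows "x \<bullet> (A *v y) = (transpose A *v x) \<bullet> y"
  by (simp add: dot_lmul_matrix transpose_matrix_vector)

lemma norm_mult_le_spectral_norm:
  fixes A :: "real^'n^'n"
  shows "norm (A *v x) \<le> spectral_norm A * norm x"
  unfolding spectral_norm_def by (rule onorm) (rule matrix_vector_mul_bounded_linear)

lemma spectral_norm_nonneg: "0 \<le> spectral_norm (A :: real^'n^'n)"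
  unfolding spectral_norm_def by (rule onorm_pos_le) (rule matrix_vector_mul_bounded_linear)

text \<open>This is \<open>\<parallel>A\<^sup>T\<parallel> \<le> \<parallel>A\<parallel>\<close>: by Cauchy-Schwarz,
  \<open>\<parallel>A\<^sup>T x\<parallel>\<^sup>2 = x \<bullet> A A\<^sup>T x \<le> \<parallel>x\<parallel> \<parallel>A\<parallel> \<parallel>A\<^sup>T x\<parallel>\<close>.\<close>

lemma norm_transpose_mult_le_spectral_norm:
  fixes A :: "real^'n^'n"
  shows "norm (transpose A *v x) \<le> spectral_norm A * norm x"
proof (cases "transpose A *v x = 0")
  case True
  then show ?thesis by (simp add: spectral_norm_nonneg)
next
  case False
  let ?y = "transpose A *v x"
  have "norm ?y * norm ?y = x \<bullet> (A *v ?y)"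
    by (simp add: inner_matrix_transpose flip: power2_eq_square power2_norm_eq_inner)
  also have "\<dots> \<le> norm x * norm (A *v ?y)"
    by (rule norm_cauchy_schwarz)
  also have "\<dots> \<le> norm x * (spectral_norm A * norm ?y)"
    by (intro mult_left_mono norm_mult_le_spectral_norm) simp
  finally have "norm ?y * norm ?y \<le> (spectral_norm A * norm x) * norm ?y"
    by (simp add: mult_ac)
  then show ?thesis using False by simp
qed

lemma invertible_iff_ker:
  fixes A :: "real^'n^'n"
  shows "invertible A \<longleftrightarrow> (\<forall>x. A *v x = 0 \<longrightarrow> x = 0)"
  by (simp add: invertible_left_inverse matrix_left_invertible_ker)

lemma matrix_inv:
  fixes A :: "real^'n^'n"
  assumes "invertible A"
  shows "matrix_inv A ** A = mat 1" and "A ** matrix_inv A = mat 1"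
  using someI_ex[OF assms[unfolded invertible_def]] by (simp_all add: matrix_inv_def)

lemma matrix_inv_unique:
  fixes A B :: "real^'n^'n"
  assumes "A ** B = mat 1"
  shows "matrix_inv A = B"
proof -
  have "invertible A" using assms invertible_right_inverse by blast
  then show ?thesis
    by (metis assms matrix_inv(1) matrix_mul_assoc matrix_mul_lid matrix_mul_rid)
qed

lemma matrix_inv_mult_vector:
  fixes A :: "real^'n^'n"
  assumes "invertible A"
  shows "A *v (matrix_inv A *v x) = x"
  by (metis assms matrix_inv(2) matrix_vector_mul_assoc matrix_vector_mul_lid)

section \<open>Generalized eigenvalues of a symmetric pair\<close>

lemma map_matrix_of_real_vec_nth:
  fixes A :: "real^'n^'n"
  shows "Re ((map_matrix complex_of_real A *v v) $ i) = (A *v (\<chi> j. Re (v $ j))) $ i"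
    and "Im ((map_matrix complex_of_real A *v v) $ i) = (A *v (\<chi> j. Im (v $ j))) $ i"
  by (simp_all add: matrix_vector_mult_def map_matrix_def)

text \<open>Let \<open>v = a + i b\<close> be an eigenvector, so that
  \<open>S v = \<mu> H v\<close>. Separating real and imaginary parts and pairing with \<open>b\<close> and \<open>a\<close>, the symmetry of
  \<open>S\<close> and \<open>H\<close> gives \<open>Im \<mu> (a \<bullet> H a + b \<bullet> H b) = 0\<close>, so \<open>\<mu>\<close> is real. Then each nonzero one of
  \<open>a\<close> and \<open>b\<close> is itself a real eigenvector, and \<open>\<mu>\<close> is its Rayleigh quotient.\<close>

lemma eigenvalue_of_symmetric_pair:
  fixes S H :: "real^'n^'n"
  assumes symS: "transpose S = S" and symH: "transpose H = H"
    and pos: "\<And>x. x \<noteq> 0 \<Longrightarrow> 0 < x \<bullet> (H *v x)"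
    and lower: "\<And>x. l * (x \<bullet> (H *v x)) \<le> x \<bullet> (S *v x)"
    and upper: "\<And>x. x \<bullet> (S *v x) \<le> u * (x \<bullet> (H *v x))"
    and eig: "is_eigenvalue (matrix_inv H ** S) \<mu>"
  shows "\<mu> \<in> \<real> \<and> l \<le> Re \<mu> \<and> Re \<mu> \<le> u"
proof -
  have invH: "invertible H"
    unfolding invertible_iff_ker using pos by (metis inner_zero_right less_irrefl)
  obtain v where v: "v \<noteq> 0"
    and ev: "map_matrix complex_of_real (matrix_inv H ** S) *v v = \<mu> *s v"
    using eig unfolding is_eigenvalue_def by blast
  define a b where "a = (\<chi> j. Re (v $ j))" and "b = (\<chi> j. Im (v $ j))"
  have ab: "a \<noteq> 0 \<or> b \<noteq> 0"
    using v by (auto simp: a_def b_def vec_eq_iff complex_eq_iff)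
  have Ka: "(matrix_inv H ** S) *v a = Re \<mu> *\<^sub>R a - Im \<mu> *\<^sub>R b"
    unfolding vec_eq_iff
    by (auto simp: a_def b_def ev simp flip: map_matrix_of_real_vec_nth)
  have Kb: "(matrix_inv H ** S) *v b = Im \<mu> *\<^sub>R a + Re \<mu> *\<^sub>R b"
    unfolding vec_eq_iff
    by (auto simp: a_def b_def ev simp flip: map_matrix_of_real_vec_nth)
  have SH: "S *v x = H *v ((matrix_inv H ** S) *v x)" for x
    using matrix_inv_mult_vector[OF invH] by (simp flip: matrix_vector_mul_assoc)
  have Sa: "S *v a = Re \<mu> *\<^sub>R (H *v a) - Im \<mu> *\<^sub>R (H *v b)"
    by (simp add: SH[of a] Ka matrix_vector_mult_diff_distrib matrix_vector_mult_scaleR)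
  have Sb: "S *v b = Im \<mu> *\<^sub>R (H *v a) + Re \<mu> *\<^sub>R (H *v b)"
    by (simp add: SH[of b] Kb matrix_vector_right_distrib matrix_vector_mult_scaleR)
  have swapS: "a \<bullet> (S *v b) = b \<bullet> (S *v a)"
    by (simp add: inner_matrix_transpose[of a] symS inner_commute)
  have swapH: "a \<bullet> (H *v b) = b \<bullet> (H *v a)"
    by (simp add: inner_matrix_transpose[of a] symH inner_commute)
  have nonneg: "0 \<le> x \<bullet> (H *v x)" for x
    using pos[of x] by (cases "x = 0") auto
  have "0 < a \<bullet> (H *v a) + b \<bullet> (H *v b)"
    using ab pos nonneg by (metis add_nonneg_pos add_pos_nonneg)
  moreover have "Im \<mu> * (a \<bullet> (H *v a) + b \<bullet> (H *v b)) = 0"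
    using swapS unfolding Sa Sb by (simp add: inner_diff_right inner_add_right swapH algebra_simps)
  ultimately have im: "Im \<mu> = 0" by auto
  obtain x where x: "x \<noteq> 0" "S *v x = Re \<mu> *\<^sub>R (H *v x)"
    using ab Sa Sb im by auto
  have "l * (x \<bullet> (H *v x)) \<le> Re \<mu> * (x \<bullet> (H *v x))" "Re \<mu> * (x \<bullet> (H *v x)) \<le> u * (x \<bullet> (H *v x))"
    using lower[of x] upper[of x] by (simp_all add: x(2))
  then show ?thesis
    using pos[OF x(1)] im by (simp add: complex_is_Real_iff)
qed

section \<open>Comparing a sum of Gram matrices with the Gram matrix of the sum\<close>

lemma inner_gram:
  fixes A :: "real^'n^'m"
  shows "x \<bullet> ((A ** transpose A) *v x) = (norm (transpose A *v x))\<^sup>2"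
  by (simp add: power2_norm_eq_inner inner_matrix_transpose flip: matrix_vector_mul_assoc)

lemma norm_add_square_le:
  fixes p q :: "'a::real_inner"
  shows "(norm (p + q))\<^sup>2 / 2 \<le> (norm p)\<^sup>2 + (norm q)\<^sup>2"
proof -
  have "0 \<le> (norm (p - q))\<^sup>2" by simp
  then show ?thesis
    by (simp add: power2_norm_eq_inner inner_add_left inner_add_right inner_diff_left
        inner_diff_right inner_commute)
qed

lemma transpose_add: "transpose (A + B) = transpose A + transpose B"
  by (simp add: transpose_def vec_eq_iff)

text \<open>Transposing \<open>P = (P + Q) Z\<close> expresses both \<open>P\<^sup>T x\<close> and
  \<open>Q\<^sup>T x\<close> through the single vector \<open>y = (P + Q)\<^sup>T x\<close>, as \<open>Z\<^sup>T y\<close> and \<open>y - Z\<^sup>T y\<close>.\<close>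

lemma gram_sum_upper:
  fixes P Q Z :: "real^'n^'n"
  assumes Z: "(P + Q) ** Z = P"
  defines "z \<equiv> spectral_norm Z"
  shows "(norm (transpose P *v x))\<^sup>2 + (norm (transpose Q *v x))\<^sup>2
    \<le> (z\<^sup>2 + (1 + z)\<^sup>2) * (norm (transpose (P + Q) *v x))\<^sup>2"
proof -
  define y where "y = transpose (P + Q) *v x"
  have p: "transpose P *v x = transpose Z *v y"
    unfolding y_def by (subst Z[symmetric]) (simp add: matrix_transpose_mul matrix_vector_mul_assoc)
  have q: "transpose Q *v x = y - transpose Z *v y"
    unfolding p[symmetric] by (simp add: y_def transpose_add matrix_vector_mult_add_rdistrib)
  have np: "norm (transpose P *v x) \<le> z * norm y"
    unfolding p z_def by (rule norm_transpose_mult_le_spectral_norm)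
  have "norm (transpose Q *v x) \<le> norm y + norm (transpose Z *v y)"
    unfolding q by (rule norm_triangle_ineq4)
  also have "\<dots> \<le> (1 + z) * norm y"
    using np by (simp add: p algebra_simps)
  finally have nq: "norm (transpose Q *v x) \<le> (1 + z) * norm y" .
  show ?thesis
    using add_mono[OF power_mono[OF np, of 2] power_mono[OF nq, of 2]]
    unfolding power_mult_distrib y_def by (simp only: distrib_right norm_ge_zero simp_thms)
qed

lemma gram_sum_eigenvalue_bounds:
  fixes P Q Z :: "real^'n^'n"
  assumes inv: "invertible (P + Q)" and Z: "(P + Q) ** Z = P"
    and eig: "is_eigenvalue (matrix_inv ((P + Q) ** transpose (P + Q))
                ** (P ** transpose P + Q ** transpose Q)) \<mu>"
  shows "\<mu> \<in> \<real> \<and> 1 / 2 \<le> Re \<mu> \<and> Re \<mu> \<le> (spectral_norm Z)\<^sup>2 + (1 + spectral_norm Z)\<^sup>2"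
proof (rule eigenvalue_of_symmetric_pair[OF _ _ _ _ _ eig])
  show "transpose (P ** transpose P + Q ** transpose Q) = P ** transpose P + Q ** transpose Q"
    by (simp add: transpose_add matrix_transpose_mul)
  show "transpose ((P + Q) ** transpose (P + Q)) = (P + Q) ** transpose (P + Q)"
    by (simp add: matrix_transpose_mul)
  fix x :: "real^'n"
  have S: "x \<bullet> ((P ** transpose P + Q ** transpose Q) *v x)
      = (norm (transpose P *v x))\<^sup>2 + (norm (transpose Q *v x))\<^sup>2"
    by (simp add: matrix_vector_mult_add_rdistrib inner_add_right inner_gram)
  show "0 < x \<bullet> (((P + Q) ** transpose (P + Q)) *v x)" if "x \<noteq> 0"
  proof -
    have "invertible (transpose (P + Q))"
      using inv by (rule transpose_invertible)
    then show ?thesis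
      using that unfolding inner_gram invertible_iff_ker by auto
  qed
  show "1 / 2 * (x \<bullet> (((P + Q) ** transpose (P + Q)) *v x))
      \<le> x \<bullet> ((P ** transpose P + Q ** transpose Q) *v x)"
    unfolding S inner_gram
    using norm_add_square_le[of "transpose P *v x" "transpose Q *v x"]
    by (simp add: transpose_add matrix_vector_mult_add_rdistrib)
  show "x \<bullet> ((P ** transpose P + Q ** transpose Q) *v x)
      \<le> ((spectral_norm Z)\<^sup>2 + (1 + spectral_norm Z)\<^sup>2)
        * (x \<bullet> (((P + Q) ** transpose (P + Q)) *v x))"
    unfolding S inner_gram by (rule gram_sum_upper[OF Z])
qed

section \<open>The diagonal weight\<close>

lemma diagonal_mult_nth:
  fixes d :: "'n::finite \<Rightarrow> real"
  shows "((\<chi> i j. if i = j then d i else 0) ** A) $ i $ j = d i * A $ i $ j"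
    and "(A ** (\<chi> i j. if i = j then d i else 0)) $ i $ j = A $ i $ j * d j"
proof -
  have "(\<Sum>k\<in>UNIV. (if i = k then d i else 0) * A $ k $ j) = (\<Sum>k\<in>UNIV. if k = i then d i * A $ i $ j else 0)"
    by (rule sum.cong) auto
  then show "((\<chi> i j. if i = j then d i else 0) ** A) $ i $ j = d i * A $ i $ j"
    by (simp add: matrix_matrix_mult_def)
  have "(\<Sum>k\<in>UNIV. A $ i $ k * (if k = j then d k else 0)) = (\<Sum>k\<in>UNIV. if k = j then A $ i $ j * d j else 0)"
    by (rule sum.cong) auto
  then show "(A ** (\<chi> i j. if i = j then d i else 0)) $ i $ j = A $ i $ j * d j"
    by (simp add: matrix_matrix_mult_def)
qed

lemma sel_matrix_diagonal:
  "sel_matrix I = (\<chi> i j. if i = j then (if i \<in> I then 1 else 0) else 0)"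
  by (simp add: sel_matrix_def vec_eq_iff)

lemma sel_matrix_idem: "sel_matrix I ** sel_matrix I = sel_matrix I"
  unfolding vec_eq_iff sel_matrix_diagonal by (simp add: diagonal_mult_nth)

lemma transpose_sel_matrix: "transpose (sel_matrix I) = sel_matrix I"
  by (auto simp: transpose_def sel_matrix_def vec_eq_iff)

lemma diag_sqrt_sel_matrix_commute: "diag_sqrt M ** sel_matrix I = sel_matrix I ** diag_sqrt M"
  unfolding vec_eq_iff sel_matrix_diagonal
  by (simp add: diagonal_mult_nth) (simp add: diag_sqrt_def)

lemma transpose_diag_sqrt: "transpose (diag_sqrt M) = diag_sqrt M"
  by (auto simp: transpose_def diag_sqrt_def vec_eq_iff)

lemma invertible_diag_sqrt:
  fixes M :: "real^'n^'n"
  assumes "pos_diagonal M"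
  shows "invertible (diag_sqrt M)"
proof -
  define R :: "real^'n^'n" where "R = (\<chi> i j. if i = j then 1 / sqrt (M $ i $ i) else 0)"
  have "sqrt (M $ i $ i) \<noteq> 0" for i
    using assms by (simp add: pos_diagonal_def order_less_imp_not_eq2)
  then have "R ** diag_sqrt M = mat 1"
    unfolding vec_eq_iff R_def diagonal_mult_nth by (auto simp: diag_sqrt_def mat_def)
  then show ?thesis
    using invertible_left_inverse by blast
qed

lemma transpose_matrix_inv:
  fixes A :: "real^'n^'n"
  assumes "invertible A"
  shows "transpose (matrix_inv A) = matrix_inv (transpose A)"
  by (metis assms matrix_inv(1) matrix_inv_unique matrix_transpose_mul transpose_mat)

lemma matrix_inv_commute:
  fixes A B :: "real^'n^'n"
  assumes "invertible A" "A ** B = B ** A"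
  shows "matrix_inv A ** B = B ** matrix_inv A"
proof -
  have "matrix_inv A ** B = matrix_inv A ** (B ** A) ** matrix_inv A"
    using assms(1) by (metis matrix_inv(2) matrix_mul_assoc matrix_mul_rid)
  also have "\<dots> = B ** matrix_inv A"
    using assms by (metis matrix_inv(1) matrix_mul_assoc matrix_mul_lid)
  finally show ?thesis .
qed

text \<open>Writing \<open>M\<^sup>-\<^sup>1 = R R\<^sup>T\<close> turns \<open>A M\<^sup>-\<^sup>1 A\<^sup>T\<close> into the
  Gram matrix of \<open>A R\<close>.\<close>

lemma matrix_inv_pos_diagonal:
  assumes "pos_diagonal M"
  shows "matrix_inv M = matrix_inv (diag_sqrt M) ** transpose (matrix_inv (diag_sqrt M))"
proof -
  have E: "invertible (diag_sqrt M)" by (rule invertible_diag_sqrt[OF assms])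
  let ?R = "matrix_inv (diag_sqrt M)"
  have ER: "diag_sqrt M ** ?R = mat 1"
    by (rule matrix_inv(2)[OF E])
  have "matrix_inv (diag_sqrt M ** diag_sqrt M) = ?R ** ?R"
    by (rule matrix_inv_unique) (metis ER matrix_mul_assoc matrix_mul_rid)
  then show ?thesis
    by (simp add: diag_sqrt_square[OF assms] transpose_matrix_inv[OF E] transpose_diag_sqrt)
qed

section \<open>Boundedness of zeta\<close>

text \<open>The constant is the minimum of the quadratic form on the unit sphere,
  attained by compactness and hence positive.\<close>

lemma pos_def_coercive:
  fixes X :: "real^'n^'n"
  assumes "pos_def X"
  obtains c where "0 < c" "\<And>x. c * (norm x)\<^sup>2 \<le> x \<bullet> (X *v x)"
proof -
  have "continuous_on (sphere 0 1) (\<lambda>x. x \<bullet> (X *v x))"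
    by (intro continuous_intros linear_continuous_on matrix_vector_mul_bounded_linear)
  moreover have "sphere (0::real^'n) 1 \<noteq> {}" by simp
  ultimately obtain w where w: "w \<in> sphere 0 1" "\<And>x. x \<in> sphere 0 1 \<Longrightarrow> w \<bullet> (X *v w) \<le> x \<bullet> (X *v x)"
    using continuous_attains_inf[OF compact_sphere] by blast
  show ?thesis
  proof
    have "w \<noteq> 0" using w(1) by auto
    then show "0 < w \<bullet> (X *v w)" using assms by (auto simp: pos_def_def)
    fix x :: "real^'n"
    show "w \<bullet> (X *v w) * (norm x)\<^sup>2 \<le> x \<bullet> (X *v x)"
    proof (cases "x = 0")
      case False
      have "w \<bullet> (X *v w) \<le> (x /\<^sub>R norm x) \<bullet> (X *v (x /\<^sub>R norm x))"
        by (rule w(2)) (use False in simp)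
      then show ?thesis
        using False by (simp add: matrix_vector_mult_scaleR field_simps power2_eq_square)
    qed simp
  qed
qed

text \<open>The equation scales so that the bound does not depend on
  \<open>\<alpha>\<close>: pairing it with the \<open>u\<close> that satisfies \<open>Mbar\<^sup>T u = x\<close> turns \<open>Mbar \<Pi>\<close> into the positive
  semidefinite \<open>\<Pi>\<close>, and all the other terms carry the same factor \<open>\<surd>\<alpha>\<close>. The form
  \<open>u \<bullet> L Mbar\<^sup>T u\<close> is half of the form of the positive definite matrix in the hypothesis.\<close>

lemma schur_factor_solution_bound:
  fixes L Mbar :: "real^'n^'n" and I :: "'n set"
  assumes "pos_def (L ** transpose Mbar + Mbar ** transpose L)"
  obtains K where "0 \<le> K"
    "\<And>\<alpha> x y. 0 < \<alpha> \<Longrightarrow> schur_factor L Mbar I \<alpha> *v x = sqrt \<alpha> *\<^sub>R (L *v y) \<Longrightarrow> norm x \<le> K * norm y"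
proof -
  let ?X = "L ** transpose Mbar + Mbar ** transpose L"
  have form: "u \<bullet> (?X *v u) = 2 * (u \<bullet> (L *v (transpose Mbar *v u)))" for u
  proof -
    have "u \<bullet> (Mbar *v (transpose L *v u)) = (transpose L *v u) \<bullet> (transpose Mbar *v u)"
      by (simp only: inner_matrix_transpose[of u Mbar] inner_commute)
    also have "\<dots> = u \<bullet> (L *v (transpose Mbar *v u))"
      by (rule inner_matrix_transpose[symmetric])
    finally show ?thesis
      by (simp add: matrix_vector_mult_add_rdistrib inner_add_right flip: matrix_vector_mul_assoc)
  qed
  obtain c where c: "0 < c" "\<And>u. c * (norm u)\<^sup>2 \<le> u \<bullet> (?X *v u)"
    using pos_def_coercive[OF assms] by blast
  have "u = 0" if "transpose Mbar *v u = 0" for u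
    using c(2)[of u] c(1) by (simp add: form that mult_le_0_iff)
  then have inv: "invertible (transpose Mbar)"
    by (simp add: invertible_iff_ker)
  define K where "K = spectral_norm Mbar * (2 * spectral_norm L / c)"
  show ?thesis
  proof
    show "0 \<le> K" using c(1) by (simp add: K_def spectral_norm_nonneg)
    fix \<alpha> x y
    assume \<alpha>: "0 < \<alpha>" and eq: "schur_factor L Mbar I \<alpha> *v x = sqrt \<alpha> *\<^sub>R (L *v y)"
    define u where "u = matrix_inv (transpose Mbar) *v x"
    have x: "transpose Mbar *v u = x"
      unfolding u_def by (rule matrix_inv_mult_vector[OF inv])
    \<comment> \<open>A coordinate projection is its own Gram matrix, so its quadratic form is a squared norm.\<close>
    have "u \<bullet> (Mbar *v (sel_matrix I *v x)) = x \<bullet> ((sel_matrix I ** transpose (sel_matrix I)) *v x)"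
      by (simp add: inner_matrix_transpose[of u] x transpose_sel_matrix sel_matrix_idem)
    then have sel: "0 \<le> u \<bullet> (Mbar *v (sel_matrix I *v x))"
      by (simp add: inner_gram)
    have "sqrt \<alpha> * (u \<bullet> (L *v x)) + u \<bullet> (Mbar *v (sel_matrix I *v x))
        = u \<bullet> (schur_factor L Mbar I \<alpha> *v x)"
      by (simp add: schur_factor_def matrix_vector_mult_add_rdistrib inner_add_right
          scaleR_matrix_vector_assoc[symmetric] matrix_vector_mul_assoc)
    also have "\<dots> = sqrt \<alpha> * (u \<bullet> (L *v y))"
      by (simp add: eq)
    finally have "sqrt \<alpha> * (u \<bullet> (L *v x)) \<le> sqrt \<alpha> * (u \<bullet> (L *v y))"
      using sel by simp
    then have "u \<bullet> (L *v x) \<le> u \<bullet> (L *v y)"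
      using \<alpha> by simp
    also have "\<dots> \<le> norm u * norm (L *v y)"
      by (rule norm_cauchy_schwarz)
    also have "\<dots> \<le> norm u * (spectral_norm L * norm y)"
      by (intro mult_left_mono norm_mult_le_spectral_norm) simp
    finally have "c * (norm u)\<^sup>2 \<le> 2 * (norm u * (spectral_norm L * norm y))"
      using c(2)[of u] by (simp add: form x)
    then have "norm u * (c * norm u) \<le> norm u * (2 * spectral_norm L * norm y)"
      by (simp add: power2_eq_square mult_ac)
    then have "c * norm u \<le> 2 * spectral_norm L * norm y"
      by (cases "u = 0") (simp_all add: spectral_norm_nonneg)
    then have u: "norm u \<le> 2 * spectral_norm L / c * norm y"
      using c(1) by (simp add: field_simps)
    have "norm x \<le> spectral_norm Mbar * norm u"
      using norm_transpose_mult_le_spectral_norm[of Mbar u] by (simp add: x)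
    also have "\<dots> \<le> K * norm y"
      using mult_left_mono[OF u spectral_norm_nonneg[of Mbar]] by (simp add: K_def mult_ac)
    finally show "norm x \<le> K * norm y" .
  qed
qed

section \<open>The preconditioned Schur complement\<close>

text \<open>Here \<open>R = M\<^sup>-\<^sup>1\<^sup>/\<^sup>2\<close> and \<open>E = M\<^sup>1\<^sup>/\<^sup>2\<close>. Since \<open>P + Q = F R\<close>, the matrix
  \<open>E F\<^sup>-\<^sup>1 \<surd>\<alpha> L R\<close> whose norm is \<open>\<zeta>\<close> equals \<open>(P + Q)\<^sup>-\<^sup>1 P\<close>, as the Gram comparison requires.\<close>

lemma schur_eigenvalue_bounds:
  fixes L Mbar M :: "real^'n^'n" and I :: "'n set"
  assumes M: "pos_diagonal M" and \<alpha>: "0 < \<alpha>" and F: "invertible (schur_factor L Mbar I \<alpha>)"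
    and eig: "is_eigenvalue (matrix_inv (schur_approx L Mbar M I \<alpha>) ** schur_matrix L Mbar M I \<alpha>) \<mu>"
  shows "\<mu> \<in> \<real> \<and> 1 / 2 \<le> Re \<mu> \<and> Re \<mu> \<le> (zeta L Mbar M I \<alpha>)\<^sup>2 + (1 + zeta L Mbar M I \<alpha>)\<^sup>2"
proof -
  let ?E = "diag_sqrt M" and ?F = "schur_factor L Mbar I \<alpha>"
  let ?R = "matrix_inv ?E"
  have E: "invertible ?E" by (rule invertible_diag_sqrt[OF M])
  define P where "P = (sqrt \<alpha> *\<^sub>R L) ** ?R"
  define Q where "Q = Mbar ** sel_matrix I ** ?R"
  define Z where "Z = ?E ** matrix_inv ?F ** (sqrt \<alpha> *\<^sub>R L) ** ?R"
  have G: "P + Q = ?F ** ?R"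
    by (simp add: matrix_eq P_def Q_def schur_factor_def matrix_vector_mult_add_rdistrib
        flip: matrix_vector_mul_assoc)
  have GG: "schur_approx L Mbar M I \<alpha> = (P + Q) ** transpose (P + Q)"
    by (simp add: G schur_approx_def matrix_inv_pos_diagonal[OF M] matrix_transpose_mul matrix_mul_assoc)
  have PP: "P ** transpose P = \<alpha> *\<^sub>R (L ** matrix_inv M ** transpose L)"
    using \<alpha> by (simp add: P_def matrix_inv_pos_diagonal[OF M] matrix_transpose_mul matrix_mul_assoc
        transpose_scalar matrix_scalar_ac scalar_matrix_assoc[symmetric])
  have comm: "?R ** sel_matrix I = sel_matrix I ** ?R"
    by (rule matrix_inv_commute[OF E diag_sqrt_sel_matrix_commute])
  have RR: "matrix_inv M = ?R ** ?R"
    by (simp add: matrix_inv_pos_diagonal[OF M] transpose_matrix_inv[OF E] transpose_diag_sqrt)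
  \<comment> \<open>The exact matrix contains \<open>\<Pi>\<close> once, the Gram matrix of \<open>Q\<close> twice.\<close>
  have absorb: "sel_matrix I ** matrix_inv M ** sel_matrix I = sel_matrix I ** matrix_inv M"
  proof -
    have "matrix_inv M ** sel_matrix I = sel_matrix I ** matrix_inv M"
      unfolding RR by (metis comm matrix_mul_assoc)
    then show ?thesis
      by (metis matrix_mul_assoc sel_matrix_idem)
  qed
  have "Q ** transpose Q = Mbar ** (sel_matrix I ** matrix_inv M ** sel_matrix I) ** transpose Mbar"
    by (simp add: Q_def matrix_inv_pos_diagonal[OF M] matrix_transpose_mul transpose_sel_matrix
        matrix_mul_assoc)
  then have QQ: "Q ** transpose Q = Mbar ** sel_matrix I ** matrix_inv M ** transpose Mbar"
    by (simp only: absorb) (simp only: matrix_mul_assoc)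
  have S: "schur_matrix L Mbar M I \<alpha> = P ** transpose P + Q ** transpose Q"
    by (simp add: schur_matrix_def PP QQ)
  have inv: "invertible (P + Q)"
    unfolding G using E F by (metis invertible_mult invertible_def matrix_inv)
  have "(P + Q) ** Z = ?F ** (?R ** ?E) ** matrix_inv ?F ** ((sqrt \<alpha> *\<^sub>R L) ** ?R)"
    by (simp add: G Z_def matrix_mul_assoc)
  also have "\<dots> = P"
    using matrix_inv[OF E] matrix_inv[OF F] by (simp add: P_def)
  finally have "(P + Q) ** Z = P" .
  from gram_sum_eigenvalue_bounds[OF inv this] eig
  show ?thesis
    by (simp add: GG S zeta_def Z_def)
qed

lemma zeta_bounded:
  fixes L Mbar M :: "real^'n^'n" and I :: "'n set"
  assumes "pos_def (L ** transpose Mbar + Mbar ** transpose L)"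
  obtains C where "0 < C"
    "\<And>\<alpha>. 0 < \<alpha> \<Longrightarrow> invertible (schur_factor L Mbar I \<alpha>) \<and> zeta L Mbar M I \<alpha> \<le> C"
proof -
  obtain K where K: "0 \<le> K"
    "\<And>\<alpha> x y. 0 < \<alpha> \<Longrightarrow> schur_factor L Mbar I \<alpha> *v x = sqrt \<alpha> *\<^sub>R (L *v y) \<Longrightarrow> norm x \<le> K * norm y"
    using schur_factor_solution_bound[OF assms] by blast
  let ?E = "diag_sqrt M"
  let ?R = "matrix_inv ?E"
  \<comment> \<open>The summand \<open>1\<close> keeps \<open>C\<close> positive when the product vanishes.\<close>
  define C where "C = spectral_norm ?E * (K * spectral_norm ?R) + 1"
  show ?thesis
  proof
    show "0 < C"
      unfolding C_def using K(1) by (intro add_nonneg_pos mult_nonneg_nonneg spectral_norm_nonneg) auto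
    fix \<alpha> :: real
    assume \<alpha>: "0 < \<alpha>"
    let ?F = "schur_factor L Mbar I \<alpha>"
    have inv: "invertible ?F"
      unfolding invertible_iff_ker
    proof (intro allI impI)
      fix x assume "?F *v x = 0"
      then show "x = 0" using K(2)[OF \<alpha>, of x 0] by simp
    qed
    have "zeta L Mbar M I \<alpha> \<le> spectral_norm ?E * (K * spectral_norm ?R)"
      unfolding zeta_def spectral_norm_def[of "_ ** ?R"]
    proof (rule onorm_bound)
      show "0 \<le> spectral_norm ?E * (K * spectral_norm ?R)"
        using K(1) by (intro mult_nonneg_nonneg spectral_norm_nonneg)
      fix v
      define y where "y = ?R *v v"
      define x where "x = matrix_inv ?F *v (sqrt \<alpha> *\<^sub>R (L *v y))"
      have "?F *v x = sqrt \<alpha> *\<^sub>R (L *v y)"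
        unfolding x_def by (rule matrix_inv_mult_vector[OF inv])
      then have x: "norm x \<le> K * norm y" by (rule K(2)[OF \<alpha>])
      have "(?E ** matrix_inv ?F ** (sqrt \<alpha> *\<^sub>R L) ** ?R) *v v = ?E *v x"
        by (simp add: x_def y_def scaleR_matrix_vector_assoc flip: matrix_vector_mul_assoc)
      then have "norm ((?E ** matrix_inv ?F ** (sqrt \<alpha> *\<^sub>R L) ** ?R) *v v) \<le> spectral_norm ?E * norm x"
        by (simp add: norm_mult_le_spectral_norm)
      also have "\<dots> \<le> spectral_norm ?E * (K * (spectral_norm ?R * norm v))"
        using x norm_mult_le_spectral_norm[of ?R v] K(1)
        by (intro mult_left_mono spectral_norm_nonneg) (auto simp: y_def intro: order_trans mult_left_mono)
      finally show "norm ((?E ** matrix_inv ?F ** (sqrt \<alpha> *\<^sub>R L) ** ?R) *v v)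
          \<le> spectral_norm ?E * (K * spectral_norm ?R) * norm v"
        by (simp add: mult_ac)
    qed
    then show "invertible ?F \<and> zeta L Mbar M I \<alpha> \<le> C"
      using inv by (simp add: C_def)
  qed
qed

text \<open>Since \<open>zeta_bounded\<close> is uniform over all \<open>\<alpha> > 0\<close>, any threshold
  \<open>\<alpha>\<^sub>0\<close> serves in the second part; the proof takes \<open>1\<close>.\<close>

theorem proposition4p2:
  fixes L Mbar M :: "real^'n^'n" and I :: "'n set"
  assumes "pos_diagonal M"
  shows "(\<forall>\<alpha>>0. invertible (schur_factor L Mbar I \<alpha>) \<longrightarrow>
            (\<forall>\<mu>. is_eigenvalue
                    (matrix_inv (schur_approx L Mbar M I \<alpha>) ** schur_matrix L Mbar M I \<alpha>) \<mu> \<longrightarrow>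
               \<mu> \<in> \<real> \<and> 1 / 2 \<le> Re \<mu> \<and>
               Re \<mu> \<le> (zeta L Mbar M I \<alpha>)\<^sup>2 + (1 + zeta L Mbar M I \<alpha>)\<^sup>2))
       \<and> (pos_def (L ** transpose Mbar + Mbar ** transpose L) \<longrightarrow>
            (\<exists>C>0. \<exists>\<alpha>\<^sub>0>0. \<forall>\<alpha>. 0 < \<alpha> \<and> \<alpha> \<le> \<alpha>\<^sub>0 \<longrightarrow>
               invertible (schur_factor L Mbar I \<alpha>) \<and> zeta L Mbar M I \<alpha> \<le> C))"
proof (intro conjI allI impI)
  fix \<alpha> \<mu>
  assume "0 < \<alpha>" "invertible (schur_factor L Mbar I \<alpha>)"
    "is_eigenvalue (matrix_inv (schur_approx L Mbar M I \<alpha>) ** schur_matrix L Mbar M I \<alpha>) \<mu>"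
  from schur_eigenvalue_bounds[OF assms this]
  show "\<mu> \<in> \<real>" "1 / 2 \<le> Re \<mu>"
    "Re \<mu> \<le> (zeta L Mbar M I \<alpha>)\<^sup>2 + (1 + zeta L Mbar M I \<alpha>)\<^sup>2"
    by auto
next
  assume "pos_def (L ** transpose Mbar + Mbar ** transpose L)"
  then obtain C where C: "0 < C"
    "\<And>\<alpha>. 0 < \<alpha> \<Longrightarrow> invertible (schur_factor L Mbar I \<alpha>) \<and> zeta L Mbar M I \<alpha> \<le> C"
    using zeta_bounded[where M = M] by blast
  show "\<exists>C>0. \<exists>\<alpha>\<^sub>0>0. \<forall>\<alpha>. 0 < \<alpha> \<and> \<alpha> \<le> \<alpha>\<^sub>0 \<longrightarrow>
      invertible (schur_factor L Mbar I \<alpha>) \<and> zeta L Mbar M I \<alpha> \<le> C"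
    using C by (intro exI[of _ C] conjI exI[of _ "1::real"]) auto
qed

end
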